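(* Let $n$ be an integer with $n > 2$, and let $f$ be a real function that is continuous on $[0,1]$. \begin{itemize} \item If $n$ is odd, then $$ \int_0^1 f(W_n(x)) \, dx = - \cos\frac{2\pi}{n} \int_{\frac{1-b_n}{a_n}}^{\frac{-b_n}{a_n}} f(W_n(x)) \, dx +\left(2\cos\frac{\pi}{n}-1\right) \int_0^{\frac{-b_n}{a_n}} f(W_n(x)) \, dx . $$ \item If $n$ is even, then $$ \int_{\frac{1-b_n}{a_n}}^1 f(W_n(x)) \, dx = \sin^2\frac{\pi}{n} \int_{\frac{1-b_n}{a_n}}^{\frac{-b_n}{a_n}} f(W_n(x)) \, dx . $$ \end{itemize}
   Context: The Tchebychev polynomials of the first kind $T_n(X)$ are defined by $T_0(X)=1$, $T_1(X)=X$, and $T_{n+2}(X) = 2X T_{n+1}(X) - T_n(X)$ for all $n \geq 0$; they satisfy $T_n(\cos\theta) = \cos n\theta$ for all $\theta \in \mathbb{R}$. For each integer $n>1$, the real numbers $a_n$ and $b_n$ are defined by $$ a_n := \cos^2\frac{\pi}{n} - \cos^2\frac{\pi}{2n} = \frac{1}{2}\left(\cos\frac{2\pi}{n} - \cos\frac{\pi}{n}\right), \qquad b_n := \cos^2\frac{\pi}{2n} = \frac{1}{2}\left(\cos\frac{\pi}{n}+1\right). $$ Note that $a_n<0$. The polynomial $V_n(X)$ is defined by $V_n(X^2) := T_n^2(X)$, where $T_n^2(X) = (T_n(X))^2$ (this is well defined because $T_n^2$ is an even polynomial), and the polynomial $W_n(X)$ is defined by $W_n(X) := V_n(a_n X +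 b_n)$. *)

theory Defs
  imports "HOL-Analysis.Analysis" "HOL-Computational_Algebra.Polynomial"
begin

fun cheb_poly :: "nat \<Rightarrow> real poly" where
  "cheb_poly 0 = 1"
| "cheb_poly (Suc 0) = [:0, 1:]"
| "cheb_poly (Suc (Suc n)) = 2 * [:0, 1:] * cheb_poly (Suc n) - cheb_poly n"

definition a_coeff :: "nat \<Rightarrow> real" where
  "a_coeff n = (cos (pi / real n))\<^sup>2 - (cos (pi / (2 * real n)))\<^sup>2"

definition b_coeff :: "nat \<Rightarrow> real" where
  "b_coeff n = (cos (pi / (2 * real n)))\<^sup>2"

(* [:0, 0, 1:] is X^2; the description is justified by V_poly_exists and V_poly_unique. *)
definition V_poly :: "nat \<Rightarrow> real poly" where
  "V_poly n = (THE p. pcompose p [:0, 0, 1:] = (cheb_poly n)\<^sup>2)"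

definition W_poly :: "nat \<Rightarrow> real poly" where
  "W_poly n = pcompose (V_poly n) [:b_coeff n, a_coeff n:]"

lemma cheb_poly_parity:
  "\<exists>q. cheb_poly n = (if even n then 1 else [:0, 1:]) * pcompose q [:0, 0, 1:]"
proof (induction n rule: cheb_poly.induct)
  case 1
  show ?case by (rule exI[of _ 1]) (simp add: pcompose_1)
next
  case 2
  show ?case by (rule exI[of _ 1]) (simp add: pcompose_1 one_pCons)
next
  case (3 n)
  then obtain q r where q: "cheb_poly (Suc n) = (if even (Suc n) then 1 else [:0, 1:]) * pcompose q [:0, 0, 1:]"
    and r: "cheb_poly n = (if even n then 1 else [:0, 1:]) * pcompose r [:0, 0, 1:]"
    by blast
  have X2: "[:0, 1:] * ([:0, 1:] * p) = [:0, 0, 1:] * p" for p :: "real poly"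
    by simp
  have two: "pcompose (2 :: real poly) s = 2" for s
    by (metis pcompose_const numeral_poly)
  have Xc: "pcompose [:0, 1:] [:0, 0, 1:] = ([:0, 0, 1:] :: real poly)"
    by (simp add: pcompose_pCons)
  show ?case
  proof (cases "even n")
    case True
    have "cheb_poly (Suc (Suc n)) = pcompose (2 * ([:0, 1:] * q) - r) [:0, 0, 1:]"
      using True q r X2 by (simp only: cheb_poly.simps pcompose_diff pcompose_mult two Xc) (simp add: algebra_simps)
    then show ?thesis using True by auto
  next
    case False
    have "cheb_poly (Suc (Suc n)) = [:0, 1:] * pcompose (2 * q - r) [:0, 0, 1:]"
      using False q r by (simp only: cheb_poly.simps pcompose_diff pcompose_mult two) (simp add: algebra_simps)
    then show ?thesis using False by auto
  qed
qed

lemma poly_cheb_poly_cos: "poly (cheb_poly n) (cos t) = cos (real n * t)"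
proof (induction n rule: cheb_poly.induct)
  case (3 n)
  have "cos (real (Suc (Suc n)) * t) + cos (real n * t) = 2 * cos t * cos (real (Suc n) * t)"
    using cos_plus_cos[of "real (Suc (Suc n)) * t" "real n * t"]
    by (simp add: algebra_simps add_divide_distrib)
  then show ?case using 3 by (simp add: algebra_simps)
qed auto

lemma V_poly_exists: "\<exists>p. pcompose p [:0, 0, 1:] = (cheb_poly n)\<^sup>2"
proof -
  obtain q where q: "cheb_poly n = (if even n then 1 else [:0, 1:]) * pcompose q [:0, 0, 1:]"
    using cheb_poly_parity by blast
  have "pcompose ((if even n then 1 else [:0, 1:]) * q\<^sup>2) [:0, 0, 1:] = (cheb_poly n)\<^sup>2"
    unfolding q by (simp add: pcompose_mult power2_eq_square pcompose_pCons pcompose_1)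
  then show ?thesis by blast
qed

lemma V_poly_unique:
  fixes p q :: "real poly"
  assumes "pcompose p [:0, 0, 1:] = pcompose q [:0, 0, 1:]"
  shows "p = q"
proof -
  have "pcompose (p - q) [:0, 0, 1:] = 0"
    using assms by (simp add: pcompose_diff)
  then have "p - q = 0"
    by (rule pcompose_eq_0) simp
  then show ?thesis by simp
qed

lemma V_poly_pcompose: "pcompose (V_poly n) [:0, 0, 1:] = (cheb_poly n)\<^sup>2"
  unfolding V_poly_def by (rule theI') (metis V_poly_exists V_poly_unique)

lemma a_coeff_eq: "a_coeff n = (cos (2 * pi / real n) - cos (pi / real n)) / 2"
proof -
  have "cos (2 * (pi / real n)) = 2 * (cos (pi / real n))\<^sup>2 - 1"
    by (rule cos_double_cos)
  moreover have "cos (2 * (pi / (2 * real n))) = 2 * (cos (pi / (2 * real n)))\<^sup>2 - 1"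
    by (rule cos_double_cos)
  ultimately show ?thesis unfolding a_coeff_def by (simp add: field_simps)
qed

lemma b_coeff_eq: "b_coeff n = (cos (pi / real n) + 1) / 2"
  using cos_double_cos[of "pi / (2 * real n)"] by (simp add: b_coeff_def)

(* Both endpoints lie outside [0, 1] on the expected sides, so integrals over the closed
   intervals they form agree with the oriented integrals. *)
lemma coeff_endpoints:
  assumes "n > 2"
  shows "a_coeff n < 0" "(1 - b_coeff n) / a_coeff n < 0" "1 < - b_coeff n / a_coeff n"
proof -
  have lt: "cos (pi / real n) < cos (pi / (2 * real n))"
    using assms by (intro cos_monotone_0_pi) (auto simp: field_simps)
  have pos: "0 < cos (pi / real n)"
    using assms by (intro cos_gt_zero) (auto simp: field_simps)
  have lt1: "cos (pi / (2 * real n)) < cos 0"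
    using assms by (intro cos_monotone_0_pi) (auto simp: field_simps)
  show neg: "a_coeff n < 0"
    unfolding a_coeff_def using power_strict_mono[OF lt, of 2] pos by simp
  have "b_coeff n < 1"
    unfolding b_coeff_def using lt1 lt pos by (intro power_less_one_iff[THEN iffD2]) auto
  then show "(1 - b_coeff n) / a_coeff n < 0"
    using neg by (simp add: divide_pos_neg)
  have "a_coeff n + b_coeff n > 0"
    unfolding a_coeff_def b_coeff_def using pos by simp
  then show "1 < - b_coeff n / a_coeff n"
    using neg by (simp add: field_simps)
qed

end

theory Submission
  imports Defs
begin

text \<open>Substituting \<open>a\<^sub>n x + b\<^sub>n = (1 + cos t) / 2\<close> turns \<open>f (W\<^sub>n x) dx\<close> into a constant multiple of
  \<open>G t * sin t dt\<close> with \<open>G t = f ((1 + cos (n t)) / 2)\<close>, and the points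
  \<open>(1 - b\<^sub>n) / a\<^sub>n, 0, 1, -b\<^sub>n / a\<^sub>n\<close> into \<open>0, h, 2 h, \<pi>\<close>, where \<open>h = \<pi> / n\<close>.
  As \<open>G\<close> is symmetric about every multiple of \<open>h\<close>, its integral against \<open>sin\<close> over each interval
  between consecutive multiples of \<open>h\<close> is a combination of the two numbers
  \<open>\<integral>\<^sub>0\<^sup>h G t cos t dt\<close> and \<open>\<integral>\<^sub>0\<^sup>h G t sin t dt\<close>. The coefficients telescope.\<close>

text \<open>Translating by the period \<open>a\<close> leaves \<open>G\<close> alone, and the
  addition formula for \<open>sin (a + t)\<close> pulls \<open>sin a\<close> and
  \<open>cos a\<close> out of the integral.\<close>

lemma integral_sin_shift:
  fixes G :: "real \<Rightarrow> real"
  assumes "continuous_on UNIV G" "h \<ge> 0" "\<And>t. G (a + t) = G t"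
  shows "integral {a..a + h} (\<lambda>t. G t * sin t) =
    sin a * integral {0..h} (\<lambda>t. G t * cos t) + cos a * integral {0..h} (\<lambda>t. G t * sin t)"
proof -
  have G: "continuous_on S G" for S
    using assms(1) continuous_on_subset by blast
  have "((\<lambda>t. 1 *\<^sub>R (G (a + t) * sin (a + t))) has_integral
      integral {a + 0..a + h} (\<lambda>t. G t * sin t)) {0..h}"
    by (rule has_integral_substitution[where c = a and d = "a + h"])
      (use assms(2) in \<open>auto intro!: continuous_intros G derivative_eq_intros\<close>)
  moreover have "((\<lambda>t. sin a * (G t * cos t) + cos a * (G t * sin t)) has_integral
      sin a * integral {0..h} (\<lambda>t. G t * cos t) + cos a * integral {0..h} (\<lambda>t. G t * sin t)) {0..h}"
    by (intro has_integral_add has_integral_mult_right integrable_integral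
        integrable_continuous_interval continuous_intros G)
  moreover have "(\<lambda>t. 1 *\<^sub>R (G (a + t) * sin (a + t))) =
      (\<lambda>t. sin a * (G t * cos t) + cos a * (G t * sin t))"
    unfolding assms(3) by (simp add: sin_add algebra_simps)
  ultimately show ?thesis
    by (simp only: add_0_right has_integral_iff)
qed

text \<open>Counterpart for an interval that ends at \<open>a\<close>: the substitution
  \<open>a - t\<close> preserves \<open>G\<close>, and \<open>sin (a - t)\<close> expands.\<close>

lemma integral_sin_reflect:
  fixes G :: "real \<Rightarrow> real"
  assumes "continuous_on UNIV G" "h \<ge> 0" "\<And>t. G (a - t) = G t"
  shows "integral {a - h..a} (\<lambda>t. G t * sin t) =
    sin a * integral {0..h} (\<lambda>t. G t * cos t) - cos a * integral {0..h} (\<lambda>t. G t * sin t)"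
proof -
  have G: "continuous_on S G" for S
    using assms(1) continuous_on_subset by blast
  \<comment> \<open>The substitution is decreasing, so the integral appears as a difference of two
    orientations; the one over \<open>{a - 0..a - h}\<close> vanishes, its interval being empty or a
    point.\<close>
  have "((\<lambda>t. (- 1) *\<^sub>R (G (a - t) * sin (a - t))) has_integral
      integral {a - 0..a - h} (\<lambda>t. G t * sin t) -
      integral {a - h..a - 0} (\<lambda>t. G t * sin t)) {0..h}"
  proof (rule has_integral_substitution_general[where c = "a - h" and d = a and s = "{}"])
    show "continuous_on {a - h..a} (\<lambda>t. G t * sin t)"
      by (intro continuous_intros G)
    show "continuous_on {0..h} (\<lambda>t. a - t)"
      by (intro continuous_intros)
    show "((\<lambda>t. a - t) has_real_derivative - 1) (at t within {0..h})" for t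
      by (auto intro!: derivative_eq_intros)
  qed (use assms(2) in auto)
  moreover have "integral {a - 0..a - h} (\<lambda>t. G t * sin t) = 0"
    using assms(2) by (cases "h = 0") simp_all
  ultimately have "((\<lambda>t. - (G (a - t) * sin (a - t))) has_integral
      - integral {a - h..a} (\<lambda>t. G t * sin t)) {0..h}"
    by simp
  then have "((\<lambda>t. G (a - t) * sin (a - t)) has_integral
      integral {a - h..a} (\<lambda>t. G t * sin t)) {0..h}"
    by (simp only: has_integral_neg_iff minus_minus)
  moreover have "((\<lambda>t. sin a * (G t * cos t) - cos a * (G t * sin t)) has_integral
      sin a * integral {0..h} (\<lambda>t. G t * cos t) - cos a * integral {0..h} (\<lambda>t. G t * sin t)) {0..h}"
    by (intro has_integral_diff has_integral_mult_right integrable_integral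
        integrable_continuous_interval continuous_intros G)
  moreover have "(\<lambda>t. G (a - t) * sin (a - t)) =
      (\<lambda>t. sin a * (G t * cos t) - cos a * (G t * sin t))"
    unfolding assms(3) by (simp add: sin_diff algebra_simps)
  ultimately show ?thesis
    by (simp only: has_integral_iff)
qed

text \<open>Each induction step adds two intervals of length \<open>h\<close>, the first shifted
  from its left end and the second reflected at its right end. The factor \<open>sin h\<close> makes
  the coefficients telescope without a division.\<close>

lemma integral_sin_even_multiple:
  fixes G :: "real \<Rightarrow> real"
  assumes G: "continuous_on UNIV G" and h: "h \<ge> 0"
    and even: "\<And>t. G (- t) = G t" and per: "\<And>j t. G (real (2 * j) * h + t) = G t"
  shows "sin h * integral {0..real (2 * j) * h} (\<lambda>t. G t * sin t) =
    (cos h * integral {0..h} (\<lambda>t. G t * cos t) + sin h * integral {0..h} (\<lambda>t. G t * sin t))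
      * (1 - cos (real (2 * j) * h))"
proof (induction j)
  case 0
  show ?case by simp
next
  case (Suc j)
  define a where "a = real (2 * j) * h"
  define C where "C = integral {0..h} (\<lambda>t. G t * cos t)"
  define S where "S = integral {0..h} (\<lambda>t. G t * sin t)"
  have a: "a \<ge> 0" using h by (simp add: a_def)
  have Suc_a: "real (2 * Suc j) * h = a + 2 * h"
    by (simp add: a_def algebra_simps)
  have int: "(\<lambda>t. G t * sin t) integrable_on {u..v}" for u v
    by (intro integrable_continuous_interval continuous_intros continuous_on_subset[OF G]) auto
  have i1: "integral {a..a + h} (\<lambda>t. G t * sin t) = sin a * C + cos a * S"
    unfolding C_def S_def using per by (intro integral_sin_shift G h) (simp add: a_def)
  \<comment> \<open>Evenness turns the period \<open>a + 2 * h\<close> into the symmetry needed for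
    reflection.\<close>
  have "G (a + 2 * h - t) = G t" for t
    using per[of "Suc j" "- t"] even[of t] unfolding Suc_a by simp
  from integral_sin_reflect[OF G h this]
  have i2: "integral {a + h..a + 2 * h} (\<lambda>t. G t * sin t) =
      sin (a + 2 * h) * C - cos (a + 2 * h) * S"
    unfolding C_def S_def by (simp add: add.commute)
  have "integral {0..a + 2 * h} (\<lambda>t. G t * sin t) = integral {0..a} (\<lambda>t. G t * sin t)
      + integral {a..a + h} (\<lambda>t. G t * sin t) + integral {a + h..a + 2 * h} (\<lambda>t. G t * sin t)"
    using a h int by (simp add: Henstock_Kurzweil_Integration.integral_combine)
  then have "sin h * integral {0..a + 2 * h} (\<lambda>t. G t * sin t) =
      sin h * integral {0..a} (\<lambda>t. G t * sin t)
      + sin h * (sin a * C + cos a * S) + sin h * (sin (a + 2 * h) * C - cos (a + 2 * h) * S)"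
    by (simp only: i1 i2 distrib_left)
  also have "\<dots> = (cos h * C + sin h * S) * (1 - cos a)
      + C * (sin h * (sin a + sin (a + 2 * h))) + S * (sin h * (cos a - cos (a + 2 * h)))"
    using Suc.IH unfolding a_def[symmetric] C_def[symmetric] S_def[symmetric]
    by (simp add: algebra_simps)
  \<comment> \<open>Both sides equal \<open>2 * sin h * cos h * sin (a + h)\<close>; expanding
    around the midpoint \<open>b = a + h\<close> shows it.\<close>
  also have "sin h * (sin a + sin (a + 2 * h)) = cos h * (cos a - cos (a + 2 * h))"
  proof -
    have "sin h * (sin (b - h) + sin (b + h)) = cos h * (cos (b - h) - cos (b + h))" for b
      by (simp add: sin_add sin_diff cos_add cos_diff algebra_simps)
    from this[of "a + h"] show ?thesis by (simp add: algebra_simps)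
  qed
  finally show ?case
    unfolding Suc_a C_def[symmetric] S_def[symmetric] by (simp add: algebra_simps)
qed

text \<open>Since \<open>(1 + cos t) / 2\<close> is the square of \<open>cos (t / 2)\<close>, the
  value is the square of the Tchebychev polynomial at \<open>cos (t / 2)\<close>, that is, of
  \<open>cos (n * t / 2)\<close>.\<close>

lemma poly_V_poly_cos: "poly (V_poly n) ((1 + cos t) / 2) = (1 + cos (real n * t)) / 2"
proof -
  have half: "(1 + cos s) / 2 = (cos (s / 2))\<^sup>2" for s :: real
    using cos_double_cos[of "s / 2"] by simp
  have "poly (V_poly n) ((cos (t / 2))\<^sup>2) = poly (pcompose (V_poly n) [:0, 0, 1:]) (cos (t / 2))"
    by (simp add: poly_pcompose power2_eq_square)
  also have "\<dots> = (cos (real n * (t / 2)))\<^sup>2"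
    by (simp add: V_poly_pcompose poly_cheb_poly_cos)
  finally show ?thesis by (simp add: half)
qed

lemma half_one_plus_cos_in_unit: "(1 + cos t) / 2 \<in> {0..1}" for t :: real
proof -
  have "(1 + x) / 2 \<in> {0..1}" if "- 1 \<le> x" "x \<le> 1" for x :: real
    using that by simp
  from this[OF cos_ge_minus_one cos_le_one] show ?thesis .
qed

lemma poly_V_poly_in_unit:
  assumes "0 \<le> u" "u \<le> 1"
  shows "poly (V_poly n) u \<in> {0..1}"
proof -
  have "u = (1 + cos (arccos (2 * u - 1))) / 2"
    using assms by simp
  then show ?thesis
    by (metis poly_V_poly_cos half_one_plus_cos_in_unit)
qed

text \<open>\<open>X t\<close> solves \<open>a_coeff n * x + b_coeff n = (1 + cos t) / 2\<close>. It
  increases on \<open>{0..pi}\<close> because \<open>a_coeff n\<close> is negative and the cosine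
  decreases there; its derivative supplies the factor \<open>sin t\<close>.\<close>

lemma integral_W_poly:
  fixes f :: "real \<Rightarrow> real"
  assumes n: "n > 2" and f: "continuous_on {0..1} f" and uv: "0 \<le> u" "u \<le> v" "v \<le> pi"
  defines "X \<equiv> (\<lambda>t. ((1 + cos t) / 2 - b_coeff n) / a_coeff n)"
  shows "integral {X u..X v} (\<lambda>x. f (poly (W_poly n) x)) =
    - 1 / (2 * a_coeff n) * integral {u..v} (\<lambda>t. f ((1 + cos (real n * t)) / 2) * sin t)"
proof -
  let ?a = "a_coeff n" and ?b = "b_coeff n"
  have a: "?a < 0" using coeff_endpoints[OF n] by simp
  have X_mono: "X s \<le> X t" if "0 \<le> s" "s \<le> t" "t \<le> pi" for s t
    unfolding X_def using a cos_monotone_0_pi_le[OF that]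
    by (intro divide_right_mono_neg) auto
  have W_X: "poly (W_poly n) (X t) = (1 + cos (real n * t)) / 2" for t
    using a by (simp add: W_poly_def poly_pcompose X_def poly_V_poly_cos)
  \<comment> \<open>Continuity of \<open>f\<close> is known only on \<open>{0..1}\<close>, so the
    inner function must stay there.\<close>
  have in_unit: "poly (W_poly n) x \<in> {0..1}" if "x \<in> {X 0..X pi}" for x
  proof -
    have "0 \<le> ?b + x * ?a" "?b + x * ?a \<le> 1"
      using that a by (auto simp: X_def field_simps)
    then show ?thesis
      using poly_V_poly_in_unit by (simp add: W_poly_def poly_pcompose)
  qed
  have cont: "continuous_on {X u..X v} (\<lambda>x. f (poly (W_poly n) x))"
  proof (rule continuous_on_compose2[OF f])
    show "poly (W_poly n) ` {X u..X v} \<subseteq> {0..1}"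
      using in_unit X_mono[of 0 u] X_mono[of v pi] uv by force
  qed (intro continuous_intros)
  have "((\<lambda>t. (- sin t / (2 * ?a)) *\<^sub>R f (poly (W_poly n) (X t))) has_integral
      integral {X u..X v} (\<lambda>x. f (poly (W_poly n) x))) {u..v}"
  proof (rule has_integral_substitution[OF _ _ _ cont])
    show "(X has_real_derivative - sin t / (2 * ?a)) (at t within {u..v})" for t
      unfolding X_def using a by (auto intro!: derivative_eq_intros simp: field_simps)
  qed (use X_mono uv in auto)
  then have "((\<lambda>t. (- 1 / (2 * ?a)) * (f ((1 + cos (real n * t)) / 2) * sin t)) has_integral
      integral {X u..X v} (\<lambda>x. f (poly (W_poly n) x))) {u..v}"
    unfolding W_X by (simp add: mult_ac)
  from integral_unique[OF this] show ?thesis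
    by (simp only: integral_mult_right)
qed

theorem theorem1:
  fixes n :: nat and f :: "real \<Rightarrow> real"
  assumes "n > 2" and "continuous_on {0..1} f"
  shows
    "(odd n \<longrightarrow>
        integral {0..1} (\<lambda>x. f (poly (W_poly n) x)) =
          - cos (2 * pi / real n)
              * integral {(1 - b_coeff n) / a_coeff n .. - b_coeff n / a_coeff n} (\<lambda>x. f (poly (W_poly n) x))
          + (2 * cos (pi / real n) - 1)
              * integral {0 .. - b_coeff n / a_coeff n} (\<lambda>x. f (poly (W_poly n) x)))
     \<and> (even n \<longrightarrow>
        integral {(1 - b_coeff n) / a_coeff n .. 1} (\<lambda>x. f (poly (W_poly n) x)) =
          (sin (pi / real n))\<^sup>2
              * integral {(1 - b_coeff n) / a_coeff n .. - b_coeff n / a_coeff n} (\<lambda>x. f (poly (W_poly n) x)))"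
proof -
  define h where "h = pi / real n"
  define G where "G = (\<lambda>t. f ((1 + cos (real n * t)) / 2))"
  define J where "J = (\<lambda>t. integral {0..t} (\<lambda>t. G t * sin t))"
  define C where "C = integral {0..h} (\<lambda>t. G t * cos t)"
  define S where "S = integral {0..h} (\<lambda>t. G t * sin t)"
  define k where "k = - 1 / (2 * a_coeff n)"
  let ?I = "\<lambda>u v. integral {u..v} (\<lambda>x. f (poly (W_poly n) x))"
  let ?l = "(1 - b_coeff n) / a_coeff n" and ?r = "- b_coeff n / a_coeff n"
  have a: "a_coeff n < 0" using coeff_endpoints[OF assms(1)] by simp
  have nh: "real n * h = pi" using assms(1) by (simp add: h_def)
  have h: "0 \<le> h" "2 * h \<le> pi" "h \<le> pi" and sin_h: "sin h > 0"
    using assms(1) by (auto simp: h_def field_simps intro!: sin_gt_zero)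
  have G: "continuous_on UNIV G"
    unfolding G_def
  proof (rule continuous_on_compose2[OF assms(2)])
    show "range (\<lambda>t. (1 + cos (real n * t)) / 2) \<subseteq> {0..1}"
      using half_one_plus_cos_in_unit by blast
  qed (intro continuous_intros, auto)
  have G_even: "G (- t) = G t" for t
    by (simp add: G_def)
  have G_per: "G (real (2 * j) * h + t) = G t" for j t
  proof -
    have "real n * (real (2 * j) * h + t) = 2 * real j * pi + real n * t"
      by (simp add: algebra_simps flip: nh)
    then show ?thesis by (simp add: G_def cos_add cos_2npi sin_2npi)
  qed
  have int: "(\<lambda>t. G t * sin t) integrable_on {u..v}" for u v
    by (intro integrable_continuous_interval continuous_intros continuous_on_subset[OF G]) auto
  have J: "integral {u..v} (\<lambda>t. G t * sin t) = J v - J u" if "0 \<le> u" "u \<le> v" for u v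
    using Henstock_Kurzweil_Integration.integral_combine[OF that int] by (simp add: J_def)
  have I: "?I (((1 + cos u) / 2 - b_coeff n) / a_coeff n) (((1 + cos v) / 2 - b_coeff n) / a_coeff n)
      = k * (J v - J u)" if "0 \<le> u" "u \<le> v" "v \<le> pi" for u v
    unfolding integral_W_poly[OF assms that] J[OF that(1,2), symmetric] G_def k_def ..
  \<comment> \<open>The inner endpoints: \<open>b_coeff n\<close> is \<open>(1 + cos h) / 2\<close>,
    and \<open>a_coeff n + b_coeff n\<close> is \<open>(1 + cos (2 * h)) / 2\<close>.\<close>
  have x_h: "((1 + cos h) / 2 - b_coeff n) / a_coeff n = 0"
    by (simp add: b_coeff_eq h_def add.commute)
  have x_2h: "((1 + cos (2 * h)) / 2 - b_coeff n) / a_coeff n = 1"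
  proof -
    have "(1 + cos (2 * h)) / 2 - b_coeff n = a_coeff n"
      by (simp add: b_coeff_eq a_coeff_eq h_def field_simps)
    then show ?thesis using a by simp
  qed
  have J0: "J 0 = 0" by (simp add: J_def)
  have J_even: "sin h * J (real (2 * j) * h) = (cos h * C + sin h * S) * (1 - cos (real (2 * j) * h))" for j
    unfolding J_def C_def S_def by (rule integral_sin_even_multiple[OF G h(1) G_even G_per])
  have J1: "J h = S" by (simp add: J_def S_def)
  have J2: "sin h * J (2 * h) = (cos h * C + sin h * S) * (1 - cos (2 * h))"
    using J_even[of 1] by simp
  have cos2: "cos (2 * h) = 1 - 2 * (sin h)\<^sup>2"
    by (rule cos_double_sin)
  have J2': "J (2 * h) = 2 * sin h * (cos h * C + sin h * S)"
  proof -
    have "sin h * J (2 * h) = sin h * (2 * sin h * (cos h * C + sin h * S))"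
      unfolding J2 cos2 by (simp add: power2_eq_square)
    then show ?thesis using sin_h by simp
  qed
  have I_all: "?I ?l ?r = k * J pi" using I[of 0 pi] J0 by simp
  show ?thesis
  proof (intro conjI impI)
    assume "odd n"
    then obtain m where m: "n = 2 * m + 1" by (rule oddE)
    \<comment> \<open>For odd \<open>n\<close>, \<open>pi\<close> is an odd multiple of
      \<open>h\<close>; \<open>c\<close> is the last even multiple before it, and the single
      interval from \<open>c\<close> to \<open>pi\<close> is handled by a shift.\<close>
    define c where "c = real (2 * m) * h"
    have c: "c + h = pi" using nh by (simp add: c_def m algebra_simps)
    then have "c = pi - h" by simp
    then have sc: "sin c = sin h" "cos c = - cos h" by simp_all
    have "integral {c..c + h} (\<lambda>t. G t * sin t) = sin c * C + cos c * S"
      unfolding C_def S_def using G_per by (intro integral_sin_shift G h(1)) (simp add: c_def)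
    moreover have "0 \<le> c" "c \<le> pi" using h(1) c by (simp add: c_def, linarith)
    ultimately have "J pi = J c + (sin h * C - cos h * S)"
      using J[of c pi] by (simp add: c sc)
    then have "sin h * J pi = sin h * J c + sin h * (sin h * C - cos h * S)"
      by (simp only: distrib_left)
    also have "sin h * J c = (cos h * C + sin h * S) * (1 + cos h)"
      using J_even[of m] unfolding c_def[symmetric] sc by simp
    also have "(cos h * C + sin h * S) * (1 + cos h) + sin h * (sin h * C - cos h * S) =
        C * (cos h + ((sin h)\<^sup>2 + (cos h)\<^sup>2)) + sin h * S"
      by (simp add: algebra_simps power2_eq_square del: sin_cos_squared_add3)
    also have "\<dots> = C * (cos h + 1) + sin h * S"
      by (simp only: sin_cos_squared_add)
    finally have J_pi: "sin h * (J pi - S) = (1 + cos h) * C"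
      by (simp add: algebra_simps)
    \<comment> \<open>The multiplier is chosen so that the right side becomes \<open>sin h\<close>
      times the \<open>C\<close> term of \<open>J (2 * h)\<close>; this eliminates
      \<open>C\<close>.\<close>
    have "(2 * cos h * (1 - cos h)) * (sin h * (J pi - S)) = 2 * cos h * (1 - (cos h)\<^sup>2) * C"
      unfolding J_pi by (simp add: algebra_simps power2_eq_square)
    also have "1 - (cos h)\<^sup>2 = (sin h)\<^sup>2"
      by (simp add: sin_squared_eq)
    finally have "sin h * (2 * cos h * (1 - cos h) * (J pi - S)) = sin h * (2 * cos h * sin h * C)"
      by (simp add: power2_eq_square algebra_simps)
    then have "2 * cos h * (1 - cos h) * (J pi - S) = 2 * cos h * sin h * C"
      using sin_h by simp
    moreover have "J (2 * h) = 2 * cos h * sin h * C + (1 - cos (2 * h)) * S"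
      unfolding J2' cos2 by (simp add: algebra_simps power2_eq_square)
    ultimately have "J (2 * h) = 2 * cos h * (1 - cos h) * (J pi - S) + (1 - cos (2 * h)) * S"
      by (simp only:)
    \<comment> \<open>Uses \<open>2 * cos h * (1 - cos h) = (2 * cos h - 1) - cos (2 * h)\<close>;
      the \<open>cos (2 * h)\<close> terms in \<open>J pi - S\<close> and \<open>S\<close> merge
      into one in \<open>J pi\<close>.\<close>
    then have "J (2 * h) - S = - cos (2 * h) * J pi + (2 * cos h - 1) * (J pi - S)"
      unfolding cos_double_cos[of h] by (simp add: algebra_simps power2_eq_square)
    then have "k * (J (2 * h) - S) = k * (- cos (2 * h) * J pi + (2 * cos h - 1) * (J pi - S))"
      by (simp only:)
    also have "\<dots> = - cos (2 * h) * (k * J pi) + (2 * cos h - 1) * (k * (J pi - S))"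
      by (simp add: algebra_simps)
    finally have "k * (J (2 * h) - S) =
        - cos (2 * h) * (k * J pi) + (2 * cos h - 1) * (k * (J pi - S))" .
    moreover have "?I 0 1 = k * (J (2 * h) - S)"
      using I[of h "2 * h"] h unfolding x_h x_2h J1 by simp
    moreover have "?I 0 ?r = k * (J pi - S)"
      using I[of h pi] h unfolding x_h J1 by simp
    ultimately have "?I 0 1 = - cos (2 * h) * ?I ?l ?r + (2 * cos h - 1) * ?I 0 ?r"
      unfolding I_all by simp
    then show "?I 0 1 = - cos (2 * pi / real n) * ?I ?l ?r + (2 * cos (pi / real n) - 1) * ?I 0 ?r"
      by (simp add: h_def)
  next
    assume "even n"
    then obtain m where "n = 2 * m" by (rule evenE)
    \<comment> \<open>For even \<open>n\<close>, \<open>pi\<close> is itself an even multiple of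
      \<open>h\<close>, and \<open>1 - cos pi = 2\<close>.\<close>
    then have "sin h * J pi = 2 * (cos h * C + sin h * S)"
      using J_even[of m] nh by simp
    then have "J (2 * h) = (sin h)\<^sup>2 * J pi"
      unfolding J2' by (simp add: power2_eq_square)
    moreover have "?I ?l 1 = k * J (2 * h)"
      using I[of 0 "2 * h"] h unfolding x_2h J0 by simp
    ultimately have "?I ?l 1 = (sin h)\<^sup>2 * ?I ?l ?r"
      unfolding I_all by simp
    then show "?I ?l 1 = (sin (pi / real n))\<^sup>2 * ?I ?l ?r"
      by (simp add: h_def)
  qed
qed

end
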